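(* Let $d\ge1$, $\sigma^2>0$, $\nu>0$, $\alpha>0$, $\beta>0$, $\boldsymbol\lambda\in\mathbb{R}^d$ and $\boldsymbol\Lambda$ a $d\times d$ symmetric positive-definite matrix. For $\rho>0$ let $C_s(\mathbf{x};\rho)=\sigma^2\exp\{-\|\mathbf{x}\|^2/\rho^2\}$ and $C(\mathbf{h},u;\rho):=E_{\mathbf{v}}[C_s(\mathbf{h}-\mathbf{v}u;\rho)]$ with $\mathbf{v}\sim\mathcal{N}_d(\boldsymbol\lambda,\rho^2\boldsymbol\Lambda/2)$. Consider the hierarchy $\rho^2\mid\phi^2\sim\mathrm{Ga}(\nu,1/(4\phi^2))$ and $\phi^2\sim\mathrm{IG}(\alpha,\beta^2/4)$, and define $K(\mathbf{h},u):=E_{(\rho^2,\phi^2)}[C(\mathbf{h},u;\rho)]$. Then for all $(\mathbf{h},u)\in\mathbb{R}^d\times\mathbb{R}$, $$K(\mathbf{h},u)=\sigma^2\,|\mathbf{I}_d+u^2\boldsymbol\Lambda|^{-1/2}\,\mathcal{CH}(h_u;\nu,\alpha,\beta),$$ where $h_u:=\{(\mathbf{h}-u\boldsymbol\lambda)^\top(u^2\boldsymbol\Lambda+\mathbf{I}_d)^{-1}(\mathbf{h}-u\boldsymbol\lambda)\}^{1/2}$.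
   Context: $X\sim\mathrm{Ga}(a,b)$ means density $\frac{b^a}{\Gamma(a)}x^{a-1}e^{-bx}$, $x>0$; $X\sim\mathrm{IG}(a,b)$ means density $\frac{b^a}{\Gamma(a)}x^{-a-1}e^{-b/x}$, $x>0$. The confluent hypergeometric (CH) correlation is $\mathcal{CH}(r;\nu,\alpha,\beta)=\frac{\Gamma(\nu+\alpha)}{\Gamma(\nu)}\,\mathcal{U}(\alpha,1-\nu,r^2/\beta^2)$, where $\mathcal{U}(a,b,x)=\frac{1}{\Gamma(a)}\int_0^\infty t^{a-1}(1+t)^{b-a-1}e^{-xt}\,\mathrm{d}t$ is the confluent hypergeometric function of the second kind (for $r=0$ the value is $1$). $|\cdot|$ of a matrix is its determinant. *)

theory Defs
  imports "HOL-Analysis.Analysis"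
begin

text \<open>Densities. Gamma Ga(a,b) with rate b; inverse gamma IG(a,b).\<close>
definition gamma_dens :: "real \<Rightarrow> real \<Rightarrow> real \<Rightarrow> real" where
  "gamma_dens a b x = (if x > 0 then b powr a / Gamma a * x powr (a - 1) * exp (- b * x) else 0)"

definition invgamma_dens :: "real \<Rightarrow> real \<Rightarrow> real \<Rightarrow> real" where
  "invgamma_dens a b x = (if x > 0 then b powr a / Gamma a * x powr (- a - 1) * exp (- b / x) else 0)"

text \<open>Density of the d-variate normal N_d(m, S) (S symmetric positive definite).\<close>
definition normal_dens :: "real^'n \<Rightarrow> real^'n^'n \<Rightarrow> real^'n \<Rightarrow> real" where
  "normal_dens m S x =
     exp (- (1/2) * ((x - m) \<bullet> (matrix_inv S *v (x - m))))
     / sqrt ((2 * pi) ^ CARD('n) * det S)"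

text \<open>Confluent hypergeometric function of the second kind and the CH correlation.\<close>
definition hypU :: "real \<Rightarrow> real \<Rightarrow> real \<Rightarrow> real" where
  "hypU a b x = (1 / Gamma a) *
     (LINT t:{0<..}|lborel. t powr (a - 1) * (1 + t) powr (b - a - 1) * exp (- x * t))"

definition CH :: "real \<Rightarrow> real \<Rightarrow> real \<Rightarrow> real \<Rightarrow> real" where
  "CH r \<nu> \<alpha> \<beta> = (if r = 0 then 1
     else Gamma (\<nu> + \<alpha>) / Gamma \<nu> * hypU \<alpha> (1 - \<nu>) (r\<^sup>2 / \<beta>\<^sup>2))"

text \<open>Squared-exponential covariance C_s(x; rho).\<close>
definition Cs :: "real \<Rightarrow> real^'n \<Rightarrow> real \<Rightarrow> real" where
  "Cs \<sigma>2 x \<rho> = \<sigma>2 * exp (- (norm x)\<^sup>2 / \<rho>\<^sup>2)"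

text \<open>C(h,u;rho) = E_v[C_s(h - v u; rho)], v ~ N_d(lambda, rho^2 Lambda / 2).\<close>
definition Clag :: "real \<Rightarrow> real^'n \<Rightarrow> real^'n^'n \<Rightarrow> real^'n \<Rightarrow> real \<Rightarrow> real \<Rightarrow> real" where
  "Clag \<sigma>2 lam Lam h u \<rho> =
     (LINT v|lborel. Cs \<sigma>2 (h - u *\<^sub>R v) \<rho> * normal_dens lam ((\<rho>\<^sup>2 / 2) *\<^sub>R Lam) v)"

text \<open>K(h,u) = E over (rho^2, phi^2) with phi^2 ~ IG(alpha, beta^2/4),
  rho^2 | phi^2 ~ Ga(nu, 1/(4 phi^2)).\<close>
definition Kmix :: "real \<Rightarrow> real \<Rightarrow> real \<Rightarrow> real \<Rightarrow> real^'n \<Rightarrow> real^'n^'n \<Rightarrow> real^'n \<Rightarrow> real \<Rightarrow> real" where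
  "Kmix \<sigma>2 \<nu> \<alpha> \<beta> lam Lam h u =
     (LINT p:{0<..}|lborel. invgamma_dens \<alpha> (\<beta>\<^sup>2 / 4) p *
        (LINT r:{0<..}|lborel. gamma_dens \<nu> (1 / (4 * p)) r * Clag \<sigma>2 lam Lam h u (sqrt r)))"

end

theory Submission
  imports Defs "HOL-Probability.Probability"
begin

text \<open>For fixed \<open>\<rho>\<close> the covariance \<open>C(h, u; \<rho>)\<close> is a Gaussian integral in \<open>v\<close>.
  Completing the square, with \<open>(I + u\<^sup>2\<Lambda>)\<inverse> = I - u\<^sup>2 (\<Lambda>\<inverse> + u\<^sup>2 I)\<inverse>\<close>,
  gives \<open>C(h, u; \<rho>) = \<sigma>\<^sup>2 |I + u\<^sup>2\<Lambda>|\<^sup>-\<^sup>1\<^sup>/\<^sup>2 exp (- h\<^sub>u\<^sup>2 / \<rho>\<^sup>2)\<close>; Gaussian integrals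
  over \<open>\<real>\<^sup>d\<close> are evaluated by diagonalising the quadratic form by a congruence and changing
  variables linearly. It remains to mix \<open>exp (- q / \<rho>\<^sup>2)\<close>, \<open>q = h\<^sub>u\<^sup>2\<close>, over the hierarchy:
  substituting \<open>\<rho>\<^sup>2 = 4 \<phi>\<^sup>2 y\<close> makes \<open>y\<close> standard gamma distributed, and integrating out \<open>\<phi>\<^sup>2\<close>
  first leaves \<open>E[(y / (y + q / \<beta>\<^sup>2))\<^sup>\<alpha>]\<close> with \<open>y \<sim> Ga(\<nu>, 1)\<close>. Writing
  \<open>\<Gamma>(\<nu> + \<alpha>) (1 + t)\<^sup>-\<^sup>\<nu>\<^sup>-\<^sup>\<alpha>\<close> as a gamma integral in the Euler integral for
  \<open>U(\<alpha>, 1 - \<nu>, s)\<close> and exchanging the integrals shows that the CH correlation is the same expectation.\<close>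

section \<open>Symmetric positive definite matrices\<close>

definition sym_pos_def :: "real^'n^'n \<Rightarrow> bool" where
  "sym_pos_def A \<longleftrightarrow> transpose A = A \<and> (\<forall>x. x \<noteq> 0 \<longrightarrow> 0 < x \<bullet> (A *v x))"

lemma inner_matrix_vector_sym:
  fixes A :: "real^'n^'n"
  assumes "transpose A = A"
  shows "x \<bullet> (A *v y) = y \<bullet> (A *v x)"
  by (metis assms dot_lmul_matrix inner_commute vector_transpose_matrix)

lemma matrix_inv_invertible:
  fixes A :: "real^'n^'n"
  assumes "invertible A"
  shows "A ** matrix_inv A = mat 1 \<and> matrix_inv A ** A = mat 1"
  using assms unfolding invertible_def matrix_inv_def by (rule someI_ex)

lemma matrix_inv_unique:
  fixes A B :: "real^'n^'n"
  assumes "A ** B = mat 1"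
  shows "matrix_inv A = B"
proof -
  have "invertible A"
    using assms invertible_right_inverse by blast
  then have "matrix_inv A ** A = mat 1"
    by (simp add: matrix_inv_invertible)
  then have "matrix_inv A = matrix_inv A ** (A ** B)"
    by (simp add: assms)
  also have "\<dots> = B"
    by (simp add: matrix_mul_assoc \<open>matrix_inv A ** A = mat 1\<close>)
  finally show ?thesis .
qed

lemma det_scaleR:
  fixes A :: "real^'n^'n"
  shows "det (c *\<^sub>R A) = c ^ CARD('n) * det A"
proof -
  have "c *\<^sub>R A = (c *\<^sub>R mat 1) ** A"
    by (metis matrix_mul_lid scalar_matrix_assoc)
  moreover have "det (c *\<^sub>R mat 1 :: real^'n^'n) = c ^ CARD('n)"
    by (subst det_diagonal) (auto simp: mat_def)
  ultimately show ?thesis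
    by (simp add: det_mul)
qed

lemma invertible_if_pos_def:
  fixes A :: "real^'n^'n"
  assumes "\<And>x. x \<noteq> 0 \<Longrightarrow> 0 < x \<bullet> (A *v x)"
  shows "invertible A"
proof -
  have "A *v x = 0 \<Longrightarrow> x = 0" for x
    using assms[of x] by auto
  then have "inj ((*v) A)"
    by (metis linear_injective_0 matrix_vector_mul_linear)
  then show ?thesis
    by (metis invertible_det_nz det_nz_iff_inj matrix_vector_mul_linear matrix_of_matrix_vector_mul)
qed

lemma sym_pos_def_invertible: "sym_pos_def A \<Longrightarrow> invertible A"
  unfolding sym_pos_def_def by (simp add: invertible_if_pos_def)

lemma sym_pos_def_inner_nonneg: "sym_pos_def A \<Longrightarrow> 0 \<le> x \<bullet> (A *v x)"
  unfolding sym_pos_def_def by (cases "x = 0") (auto intro: less_imp_le)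

lemma sym_pos_def_mat_1: "sym_pos_def (mat 1)"
  by (simp add: sym_pos_def_def transpose_mat)

lemma sym_pos_def_scaleR:
  assumes "sym_pos_def A" and "0 < c"
  shows "sym_pos_def (c *\<^sub>R A)"
  using assms
  by (simp add: sym_pos_def_def transpose_scalar scaleR_matrix_vector_assoc[symmetric])

lemma transpose_add: "transpose (A + B) = transpose A + transpose B"
  by (simp add: transpose_def vec_eq_iff)

lemma sym_pos_def_add_scaleR:
  assumes "sym_pos_def A" and "sym_pos_def B" and "0 \<le> c"
  shows "sym_pos_def (A + c *\<^sub>R B)"
proof -
  have "0 \<le> c * (x \<bullet> (B *v x))" for x
    by (intro mult_nonneg_nonneg assms(3) sym_pos_def_inner_nonneg assms(2))
  then show ?thesis
    using assms unfolding sym_pos_def_def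
    by (auto simp: transpose_add transpose_scalar matrix_vector_mult_add_rdistrib
        scaleR_matrix_vector_assoc[symmetric] inner_add_right add_pos_nonneg)
qed

lemma sym_pos_def_matrix_inv:
  assumes "sym_pos_def A"
  shows "sym_pos_def (matrix_inv A)"
proof -
  let ?P = "matrix_inv A"
  have sym: "transpose A = A" and pos: "\<And>x. x \<noteq> 0 \<Longrightarrow> 0 < x \<bullet> (A *v x)"
    using assms by (auto simp: sym_pos_def_def)
  have AP: "A ** ?P = mat 1"
    using matrix_inv_invertible[OF sym_pos_def_invertible[OF assms]] by blast
  have "transpose ?P ** A = mat 1"
    by (metis AP matrix_transpose_mul sym transpose_mat)
  then have "transpose ?P = ?P"
    using matrix_inv_unique matrix_left_right_inverse by metis
  moreover have "0 < x \<bullet> (?P *v x)" if "x \<noteq> 0" for x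
  proof -
    have APx: "A *v (?P *v x) = x"
      by (simp add: AP matrix_vector_mul_assoc)
    then have "?P *v x \<noteq> 0"
      using that by auto
    then have "0 < (?P *v x) \<bullet> (A *v (?P *v x))"
      by (rule pos)
    then show ?thesis
      by (simp add: APx inner_commute)
  qed
  ultimately show ?thesis
    by (simp add: sym_pos_def_def)
qed

lemma conjugate_vectors_insert:
  fixes A :: "real^'n^'n" and q :: "'n \<Rightarrow> real^'n"
  assumes A: "sym_pos_def A" and "finite K" and "k \<notin> K"
    and diag: "\<And>i. i \<in> K \<Longrightarrow> q i $ i = 1"
    and supp: "\<And>i j. i \<in> K \<Longrightarrow> j \<notin> K \<Longrightarrow> q i $ j = 0"
    and conj: "\<And>i j. i \<in> K \<Longrightarrow> j \<in> K \<Longrightarrow> i \<noteq> j \<Longrightarrow> q i \<bullet> (A *v q j) = 0"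
  obtains v where "v $ k = 1" "\<And>j. j \<notin> insert k K \<Longrightarrow> v $ j = 0"
    "\<And>j. j \<in> K \<Longrightarrow> v \<bullet> (A *v q j) = 0"
proof
  have sym: "transpose A = A"
    using A by (simp add: sym_pos_def_def)
  have pos: "0 < q i \<bullet> (A *v q i)" if "i \<in> K" for i
  proof -
    have "q i \<noteq> 0"
      using diag[OF that] by auto
    then show ?thesis
      using A by (simp add: sym_pos_def_def)
  qed
  define c where "c i = q i \<bullet> (A *v axis k 1) / (q i \<bullet> (A *v q i))" for i
  define v where "v = axis k 1 - (\<Sum>i\<in>K. c i *\<^sub>R q i)"
  show "v $ k = 1" "\<And>j. j \<notin> insert k K \<Longrightarrow> v $ j = 0"
    using \<open>k \<notin> K\<close> supp by (auto simp: v_def axis_def)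
  show "v \<bullet> (A *v q j) = 0" if "j \<in> K" for j
  proof -
    have "(\<Sum>i\<in>K. c i * (q i \<bullet> (A *v q j))) = c j * (q j \<bullet> (A *v q j))"
      using that conj \<open>finite K\<close> by (subst sum.remove[of K j]) (auto intro!: sum.neutral)
    also have "\<dots> = axis k 1 \<bullet> (A *v q j)"
      using pos[OF that] inner_matrix_vector_sym[OF sym] by (simp add: c_def)
    finally show ?thesis
      by (simp add: v_def inner_diff_left inner_sum_left)
  qed
qed

text \<open>Gram--Schmidt orthogonalisation of the unit vectors for the inner product given by \<open>A\<close>.\<close>

lemma conjugate_vectors_exist:
  fixes A :: "real^'n^'n"
  assumes A: "sym_pos_def A"
  shows "\<exists>q::'n \<Rightarrow> real^'n. (\<forall>i\<in>K. q i $ i = 1 \<and> (\<forall>j. j \<notin> K \<longrightarrow> q i $ j = 0)) \<and>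
            (\<forall>i\<in>K. \<forall>j\<in>K. i \<noteq> j \<longrightarrow> q i \<bullet> (A *v q j) = 0)"
  using finite[of K]
proof (induction K rule: finite_induct)
  case empty
  then show ?case by simp
next
  case (insert k K)
  from insert.IH obtain q where q1: "\<forall>i\<in>K. q i $ i = 1 \<and> (\<forall>j. j \<notin> K \<longrightarrow> q i $ j = 0)"
    and q2: "\<forall>i\<in>K. \<forall>j\<in>K. i \<noteq> j \<longrightarrow> q i \<bullet> (A *v q j) = 0"
    by (elim exE conjE)
  have diag: "\<And>i. i \<in> K \<Longrightarrow> q i $ i = 1"
    and supp: "\<And>i j. i \<in> K \<Longrightarrow> j \<notin> K \<Longrightarrow> q i $ j = 0"
    and conj: "\<And>i j. i \<in> K \<Longrightarrow> j \<in> K \<Longrightarrow> i \<noteq> j \<Longrightarrow> q i \<bullet> (A *v q j) = 0"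
    using q1 q2 by blast+
  obtain v where v: "v $ k = 1" "\<And>j. j \<notin> insert k K \<Longrightarrow> v $ j = 0"
    "\<And>j. j \<in> K \<Longrightarrow> v \<bullet> (A *v q j) = 0"
    using conjugate_vectors_insert[OF A insert.hyps diag supp conj] by blast
  have sym: "transpose A = A"
    using A by (simp add: sym_pos_def_def)
  have "(q(k := v)) i \<bullet> (A *v (q(k := v)) j) = 0"
    if ij: "i \<in> insert k K" "j \<in> insert k K" "i \<noteq> j" for i j
  proof -
    consider "i = k" "j \<in> K" | "i \<in> K" "j = k" | "i \<in> K" "j \<in> K" "i \<noteq> k" "j \<noteq> k"
      using ij insert.hyps(2) by blast
    then show ?thesis
    proof cases
      case 1
      then show ?thesis
        using v(3) insert.hyps(2) by auto
    next
      case 2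
      then show ?thesis
        using v(3)[of i] inner_matrix_vector_sym[OF sym, of "q i" v] insert.hyps(2) by auto
    next
      case 3
      then show ?thesis
        using conj \<open>i \<noteq> j\<close> by simp
    qed
  qed
  moreover have "(q(k := v)) i $ i = 1 \<and> (\<forall>j. j \<notin> insert k K \<longrightarrow> (q(k := v)) i $ j = 0)"
    if "i \<in> insert k K" for i
    using that diag supp v(1,2) insert.hyps(2) by auto
  ultimately show ?case
    by blast
qed

lemma congruence_entry:
  fixes A M :: "real^'n^'n"
  shows "(transpose M ** A ** M) $ i $ j = (M *v axis i 1) \<bullet> (A *v (M *v axis j 1))"
  by (simp add: matrix_matrix_mult_def matrix_vector_mult_def transpose_def inner_vec_def axis_def
       sum_distrib_left sum_distrib_right mult_ac if_distrib sum.delta cong: if_cong)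
     (subst sum.swap, simp add: sum_distrib_left mult_ac)

lemma sym_pos_def_congruent_diagonal:
  fixes A :: "real^'n^'n"
  assumes A: "sym_pos_def A"
  obtains M where "det M \<noteq> 0" "\<And>i j. i \<noteq> j \<Longrightarrow> (transpose M ** A ** M) $ i $ j = 0"
    "\<And>i. 0 < (transpose M ** A ** M) $ i $ i"
proof -
  obtain q :: "'n \<Rightarrow> real^'n" where q1: "\<And>i. q i $ i = 1"
    and q2: "\<And>i j. i \<noteq> j \<Longrightarrow> q i \<bullet> (A *v q j) = 0"
    using conjugate_vectors_exist[OF A, of UNIV] by auto
  define M :: "real^'n^'n" where "M = (\<chi> r c. q c $ r)"
  have Mq: "M *v axis j 1 = q j" for j
    by (simp add: M_def matrix_vector_mult_def axis_def vec_eq_iff if_distrib sum.delta cong: if_cong)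
  let ?D = "transpose M ** A ** M"
  have off: "?D $ i $ j = 0" if "i \<noteq> j" for i j
    using q2[OF that] by (simp add: congruence_entry Mq)
  have pos: "0 < ?D $ i $ i" for i
  proof -
    have "q i \<noteq> 0"
      using q1[of i] by auto
    then show ?thesis
      using A by (simp add: sym_pos_def_def congruence_entry Mq)
  qed
  have "det ?D = (\<Prod>i\<in>UNIV. ?D $ i $ i)"
    using off by (intro det_diagonal) auto
  also have "\<dots> \<noteq> 0"
    using pos by (simp add: less_imp_neq[symmetric])
  finally have "det M \<noteq> 0"
    by (auto simp: det_mul)
  with off pos that show ?thesis by blast
qed

lemma sym_pos_def_det_pos:
  assumes A: "sym_pos_def A"
  shows "0 < det A"
proof -
  obtain M where M: "det M \<noteq> 0" "\<And>i j. i \<noteq> j \<Longrightarrow> (transpose M ** A ** M) $ i $ j = 0"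
    "\<And>i. 0 < (transpose M ** A ** M) $ i $ i"
    using sym_pos_def_congruent_diagonal[OF A] by blast
  have "det (transpose M ** A ** M) = (\<Prod>i\<in>UNIV. (transpose M ** A ** M) $ i $ i)"
    using M(2) by (intro det_diagonal) auto
  then have "0 < det M * det M * det A"
    using M(3) by (simp add: det_mul prod_pos mult_ac)
  then show ?thesis
    using M(1) by (simp add: zero_less_mult_iff)
qed

lemma inner_matrix_vector_congruence:
  fixes A M :: "real^'n^'n"
  shows "(M *v y) \<bullet> (A *v (M *v y)) = y \<bullet> ((transpose M ** A ** M) *v y)"
  by (metis dot_lmul_matrix matrix_vector_mul_assoc vector_transpose_matrix)

lemma inner_matrix_vector_diagonal:
  fixes D :: "real^'n^'n"
  assumes "\<And>i j. i \<noteq> j \<Longrightarrow> D $ i $ j = 0"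
  shows "y \<bullet> (D *v y) = (\<Sum>i\<in>UNIV. D $ i $ i * (y $ i)\<^sup>2)"
proof -
  have "(\<Sum>j\<in>UNIV. D $ i $ j * y $ j) = D $ i $ i * y $ i" for i
    by (subst sum.remove[of UNIV i]) (auto intro!: sum.neutral simp: assms)
  then show ?thesis
    by (simp add: inner_vec_def matrix_vector_mult_def power2_eq_square mult_ac)
qed

section \<open>Linear change of variables\<close>

lemma det_matrix_shear:
  fixes m n :: "'n::finite"
  assumes "m \<noteq> n"
  shows "det (matrix (\<lambda>v::real^'n. \<chi> i. if i = m then v $ m + v $ n else v $ i)) = 1"
proof -
  have "matrix (\<lambda>v::real^'n. \<chi> i. if i = m then v $ m + v $ n else v $ i)
      = (\<chi> k. if k = m then row m (mat 1) + 1 *s row n (mat 1) else row k (mat 1))"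
    by (auto simp: vec_eq_iff matrix_def row_def mat_def axis_def)
  then show ?thesis
    using det_row_operation[OF assms, of "mat 1 :: real^'n^'n" 1] by simp
qed

lemma measure_swap_coordinates_image:
  fixes S :: "(real^'n::finite) set" and m n :: 'n
  defines "h \<equiv> \<lambda>v::real^'n. \<chi> i. v $ Transposition.transpose m n i"
  assumes "S \<in> lmeasurable"
  shows "h ` S \<in> lmeasurable \<and> measure lebesgue (h ` S) = \<bar>det (matrix h)\<bar> * measure lebesgue S"
proof -
  have lin: "linear h"
    by (rule linearI) (simp_all add: h_def plus_vec_def scaleR_vec_def)
  have box: "measure lebesgue (h ` cbox a b) = measure lebesgue (cbox a b)" for a b
  proof (cases "cbox a b = {}")
    case False
    then have ne: "h ` cbox a b \<noteq> {}"
      by blast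
    have "h ` cbox a b = cbox (h a) (h b)"
      unfolding h_def
      by (auto simp: image_iff lambda_swap_Galois mem_box_cart) (metis transpose_involutory)+
    then show ?thesis
      using ne prod.permute[OF permutes_swap_id, where S=UNIV and g="\<lambda>i. (b - a)$i", symmetric]
      by (simp add: content_cbox_cart False h_def)
  qed simp
  have "(\<chi> i j. if Transposition.transpose m n i = j then 1 else 0)
      = (\<chi> i j. if j = Transposition.transpose m n i then 1 else (0::real))"
    by (auto intro!: Cart_lambda_cong)
  then have "matrix h = transpose (\<chi> i j. mat 1 $ i $ Transposition.transpose m n j)"
    by (auto simp: h_def matrix_eq transpose_def axis_def mat_def matrix_def)
  then have "\<bar>det (matrix h)\<bar> = 1"
    by (simp add: det_permute_columns permutes_swap_id sign_swap_id abs_mult)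
  then show ?thesis
    using measure_linear_sufficient[OF lin assms(2)] box by force
qed

lemma measure_shear_image:
  fixes S :: "(real^'n::finite) set" and m n :: 'n
  defines "h \<equiv> \<lambda>v::real^'n. \<chi> i. if i = m then v $ m + v $ n else v $ i"
  assumes "m \<noteq> n" and "S \<in> lmeasurable"
  shows "h ` S \<in> lmeasurable \<and> measure lebesgue (h ` S) = \<bar>det (matrix h)\<bar> * measure lebesgue S"
proof -
  have lin: "linear h"
    by (rule linearI) (auto simp: h_def algebra_simps plus_vec_def scaleR_vec_def vec_eq_iff)
  have box: "measure lebesgue (h ` cbox a b) = measure lebesgue (cbox a b)" for a b
  proof (cases "cbox a b = {}")
    case False
    define v :: "real^'n" where "v = (\<chi> i. if i = n then - a $ n else 0)"
    have shifted: "(+) v ` cbox a b = cbox (v + a) (v + b)"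
      by (simp add: cbox_translation)
    have eq: "h ` cbox a b = (+) (\<chi> i. if i = m \<or> i = n then a $ n else 0) ` h ` (+) v ` cbox a b"
      using \<open>m \<noteq> n\<close> unfolding h_def v_def image_comp o_def by (force simp: vec_eq_iff)
    have "measure lebesgue (h ` cbox a b) = measure lebesgue (h ` cbox (v + a) (v + b))"
      unfolding eq shifted[symmetric] by (rule measure_translation)
    also have "\<dots> = measure lebesgue (cbox (v + a) (v + b))"
      unfolding h_def using \<open>m \<noteq> n\<close> False shifted
      by (intro measure_shear_interval) (auto simp: v_def)
    also have "\<dots> = measure lebesgue (cbox a b)"
      unfolding shifted[symmetric] by (rule measure_translation)
    finally show ?thesis .
  qed simp
  have "det (matrix h) = 1"
    unfolding h_def by (rule det_matrix_shear[OF assms(2)])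
  then show ?thesis
    using measure_linear_sufficient[OF lin assms(3)] box by force
qed

text \<open>\<open>Change_Of_Vars\<close> proves this for index types of class \<open>wellorder\<close>, which it uses only
  to compute the determinant of a shear; \<open>det_matrix_shear\<close> makes the order unnecessary.\<close>

lemma measure_linear_image_cart:
  fixes f :: "real^'n::finite \<Rightarrow> real^'n"
  assumes "linear f" "S \<in> lmeasurable"
  shows "f ` S \<in> lmeasurable \<and> measure lebesgue (f ` S) = \<bar>det (matrix f)\<bar> * measure lebesgue S"
proof -
  let ?Q = "\<lambda>f S. measure lebesgue (f ` S) = \<bar>det (matrix f)\<bar> * measure lebesgue (S::(real^'n) set)"
  have "\<forall>S \<in> lmeasurable. f ` S \<in> lmeasurable \<and> ?Q f S"
  proof (rule induct_linear_elementary[OF \<open>linear f\<close>]; intro ballI)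
    fix f g and S :: "(real^'n) set"
    assume "linear f" "linear g"
      and f: "\<forall>S \<in> lmeasurable. f ` S \<in> lmeasurable \<and> ?Q f S"
      and g: "\<forall>S \<in> lmeasurable. g ` S \<in> lmeasurable \<and> ?Q g S" and S: "S \<in> lmeasurable"
    have "g ` S \<in> lmeasurable" "?Q g S"
      using g S by blast+
    moreover from this(1) have "f ` g ` S \<in> lmeasurable" "?Q f (g ` S)"
      using f by blast+
    ultimately show "(f \<circ> g) ` S \<in> lmeasurable \<and> ?Q (f \<circ> g) S"
      using matrix_compose[OF \<open>linear g\<close> \<open>linear f\<close>]
      by (simp add: image_image abs_mult det_mul mult.assoc)
  next
    fix f :: "real^'n \<Rightarrow> real^'n" and i and S :: "(real^'n) set"
    assume "linear f" "\<And>x. f x $ i = 0"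
    then have "\<not> inj f"
      by (metis linear_injective_imp_surjective one_neq_zero surjE vec_component)
    then have "negligible (f ` S)" "det (matrix f) = 0"
      using \<open>linear f\<close> det_nz_iff_inj negligible_linear_singular_image by blast+
    then show "f ` S \<in> lmeasurable \<and> ?Q f S"
      by (simp add: negligible_imp_measure0 negligible_imp_measurable)
  next
    fix c and S :: "(real^'n) set"
    assume "S \<in> lmeasurable"
    then show "(\<lambda>a. \<chi> i. c i * a $ i) ` S \<in> lmeasurable \<and> ?Q (\<lambda>a. \<chi> i. c i * a $ i) S"
      by (simp add: measurable_stretch measure_stretch axis_def matrix_def det_diagonal)
  qed (use measure_swap_coordinates_image measure_shear_image in blast)+
  with assms show ?thesis
    by blast
qed

lemma lborel_eq_density_linear:
  fixes g :: "real^'n::finite \<Rightarrow> real^'n"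
  assumes lin: "linear g" and det: "det (matrix g) \<noteq> 0"
  shows "lborel = density (distr lborel borel g) (\<lambda>_. ennreal \<bar>det (matrix g)\<bar>)"
proof (rule lborel_eqI)
  have "inj g"
    using det det_nz_iff_inj[OF lin] by blast
  then obtain h where h: "linear h" "h \<circ> g = id"
    using linear_injective_left_inverse[OF lin] by blast
  have hg: "h (g x) = x" for x
    using h(2) by (metis comp_apply id_apply)
  have gh: "g (h y) = y" for y
    using linear_injective_imp_surjective[OF lin \<open>inj g\<close>] hg by (metis surjD)
  have preimage: "g -` B = h ` B" for B
    by (auto simp: image_iff) (metis hg, metis gh)
  have det_inv: "det (matrix h) * det (matrix g) = 1"
    using matrix_compose[OF lin h(1)] h(2) det_mul by (metis matrix_id)
  have [measurable]: "g \<in> borel_measurable borel"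
    by (intro borel_measurable_continuous_onI linear_continuous_on)
       (simp add: lin linear_conv_bounded_linear[symmetric])
  fix l u :: "real^'n"
  assume le: "\<And>b. b \<in> Basis \<Longrightarrow> l \<bullet> b \<le> u \<bullet> b"
  have "g -` box l u \<in> sets borel"
    using measurable_sets[of g borel borel "box l u"] by simp
  then have "emeasure lborel (g -` box l u) = emeasure lebesgue (h ` box l u)"
    by (simp add: preimage emeasure_completion[symmetric])
  also have "\<dots> = ennreal (\<bar>det (matrix h)\<bar> * measure lebesgue (box l u))"
    using measure_linear_image_cart[OF h(1), of "box l u"] by (simp add: emeasure_eq_measure2)
  finally have "emeasure (density (distr lborel borel g) (\<lambda>_. ennreal \<bar>det (matrix g)\<bar>)) (box l u)
      = ennreal \<bar>det (matrix g)\<bar> * ennreal (\<bar>det (matrix h)\<bar> * measure lebesgue (box l u))"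
    by (simp add: emeasure_density emeasure_distr nn_integral_cmult_indicator)
  also have "\<dots> = ennreal (measure lebesgue (box l u))"
    using det_inv by (simp add: ennreal_mult'[symmetric] abs_mult[symmetric] mult.commute
        flip: mult.assoc)
  also have "\<dots> = (\<Prod>b\<in>Basis. (u - l) \<bullet> b)"
    using le by (simp add: measure_lborel_box_eq[symmetric] measure_completion emeasure_lborel_box_eq
        prod_nonneg inner_diff_left)
  finally show "emeasure (density (distr lborel borel g) (\<lambda>_. ennreal \<bar>det (matrix g)\<bar>)) (box l u)
      = (\<Prod>b\<in>Basis. (u - l) \<bullet> b)" .
qed simp

lemma nn_integral_linear_change_of_variables:
  fixes f :: "real^'n::finite \<Rightarrow> ennreal" and M :: "real^'n^'n"
  assumes [measurable]: "f \<in> borel_measurable borel" and "det M \<noteq> 0"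
  shows "(\<integral>\<^sup>+x. f x \<partial>lborel) = ennreal \<bar>det M\<bar> * (\<integral>\<^sup>+y. f (M *v y) \<partial>lborel)"
proof -
  have [measurable]: "(*v) M \<in> borel_measurable borel"
    by (intro borel_measurable_continuous_onI linear_continuous_on)
       (simp add: linear_conv_bounded_linear[symmetric])
  have "(\<integral>\<^sup>+x. f x \<partial>lborel)
      = (\<integral>\<^sup>+x. f x \<partial>density (distr lborel borel ((*v) M)) (\<lambda>_. ennreal \<bar>det M\<bar>))"
    using lborel_eq_density_linear[of "(*v) M"] assms(2) by simp
  then show ?thesis
    by (simp add: nn_integral_density nn_integral_distr nn_integral_cmult)
qed

section \<open>Gaussian integrals\<close>

lemma prod_Basis_vec:
  "(\<Prod>b\<in>(Basis :: (real^'n::finite) set). f b) = (\<Prod>i\<in>UNIV. f (axis i 1))"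
proof -
  have "inj (\<lambda>i::'n. axis i (1::real))"
    by (auto simp: inj_def axis_eq_axis)
  moreover have "(Basis :: (real^'n) set) = range (\<lambda>i. axis i 1)"
    by (auto simp: Basis_vec_def)
  ultimately show ?thesis
    by (metis prod.reindex comp_apply prod.cong)
qed

lemma continuous_on_matrix_vector_mult [continuous_intros]:
  fixes A :: "real^'n::finite^'m::finite"
  assumes "continuous_on S f"
  shows "continuous_on S (\<lambda>x. A *v f x)"
  using continuous_on_compose2[OF linear_continuous_on[OF matrix_vector_mul_bounded_linear] assms]
  by auto

lemma nn_integral_gaussian_1d:
  fixes d :: real
  assumes "0 < d"
  shows "(\<integral>\<^sup>+x. ennreal (exp (- (d * x\<^sup>2))) \<partial>lborel) = ennreal (sqrt (pi / d))"
proof -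
  define s where "s = sqrt (1 / (2 * d))"
  have s: "0 < s" "s\<^sup>2 = 1 / (2 * d)"
    using assms by (simp_all add: s_def)
  have density: "exp (- (d * x\<^sup>2)) = sqrt (pi / d) * normal_density 0 s x" for x
  proof -
    have "sqrt (2 * pi * s\<^sup>2) = sqrt (pi / d)" and "- x\<^sup>2 / (2 * s\<^sup>2) = - (d * x\<^sup>2)"
      using assms by (simp_all add: s(2) field_simps)
    then show ?thesis
      using assms by (simp add: normal_density_def)
  qed
  have "(\<integral>\<^sup>+x. ennreal (normal_density 0 s x) \<partial>lborel) = 1"
    by (subst nn_integral_eq_integral)
       (auto simp: integrable_normal_density[OF s(1)] integral_normal_density[OF s(1)])
  then show ?thesis
    using assms by (simp add: density ennreal_mult nn_integral_cmult)
qed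

lemma real_sqrt_prod: "sqrt (prod f A) = (\<Prod>i\<in>A. sqrt (f i))"
  by (induction A rule: infinite_finite_induct) (auto simp: real_sqrt_mult)

lemma nn_integral_gaussian_diagonal:
  fixes D :: "real^'n::finite^'n"
  assumes off: "\<And>i j. i \<noteq> j \<Longrightarrow> D $ i $ j = 0" and pos: "\<And>i. 0 < D $ i $ i"
  shows "(\<integral>\<^sup>+y. ennreal (exp (- (y \<bullet> (D *v y)))) \<partial>lborel)
    = ennreal (sqrt (pi ^ CARD('n) / det D))"
proof -
  define e where "e b = b \<bullet> (D *v b)" for b :: "real^'n"
  have e_axis: "e (axis i 1) = D $ i $ i" for i
  proof -
    have "e (axis i 1) = (\<Sum>j\<in>UNIV. D $ j $ j * (axis i 1 $ j)\<^sup>2)"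
      unfolding e_def by (rule inner_matrix_vector_diagonal[OF off])
    also have "\<dots> = (\<Sum>j\<in>UNIV. if j = i then D $ j $ j else 0)"
      by (intro sum.cong) (auto simp: axis_def)
    also have "\<dots> = D $ i $ i"
      by simp
    finally show ?thesis .
  qed
  have e_pos: "0 < e b" if "b \<in> Basis" for b
    using that e_axis pos by (auto simp: Basis_vec_def)
  have "exp (- (y \<bullet> (D *v y))) = (\<Prod>b\<in>Basis. exp (- (e b * (y \<bullet> b)\<^sup>2)))" for y
    unfolding inner_matrix_vector_diagonal[OF off] prod_Basis_vec
    by (simp add: e_axis inner_axis inner_matrix_vector_diagonal[OF off] exp_sum[symmetric] sum_negf)
  then have "(\<integral>\<^sup>+y. ennreal (exp (- (y \<bullet> (D *v y)))) \<partial>lborel)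
      = (\<integral>\<^sup>+y. (\<Prod>b\<in>Basis. ennreal (exp (- (e b * (y \<bullet> b)\<^sup>2)))) \<partial>lborel)"
    by (simp add: prod_ennreal)
  also have "\<dots> = (\<Prod>b\<in>Basis. \<integral>\<^sup>+t. ennreal (exp (- (e b * t\<^sup>2))) \<partial>lborel)"
    by (rule nn_integral_lborel_prod) auto
  also have "\<dots> = (\<Prod>b\<in>Basis. ennreal (sqrt (pi / e b)))"
    by (intro prod.cong refl nn_integral_gaussian_1d e_pos)
  also have "\<dots> = ennreal (\<Prod>i\<in>UNIV. sqrt (pi / D $ i $ i))"
    unfolding prod_Basis_vec e_axis using pos by (intro prod_ennreal) (simp add: less_imp_le)
  also have "(\<Prod>i\<in>UNIV. sqrt (pi / D $ i $ i)) = sqrt (pi ^ CARD('n) / det D)"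
    using det_diagonal[of D] off by (simp add: real_sqrt_prod[symmetric] prod_dividef)
  finally show ?thesis .
qed

lemma nn_integral_gaussian:
  fixes A :: "real^'n::finite^'n"
  assumes A: "sym_pos_def A"
  shows "(\<integral>\<^sup>+x. ennreal (exp (- (x \<bullet> (A *v x)))) \<partial>lborel)
    = ennreal (sqrt (pi ^ CARD('n) / det A))"
proof -
  obtain M where M: "det M \<noteq> 0" and off: "\<And>i j. i \<noteq> j \<Longrightarrow> (transpose M ** A ** M) $ i $ j = 0"
    and pos: "\<And>i. 0 < (transpose M ** A ** M) $ i $ i"
    using sym_pos_def_congruent_diagonal[OF A] by blast
  have det_congr: "det (transpose M ** A ** M) = det M * det M * det A"
    by (simp add: det_mul)
  have "(\<integral>\<^sup>+x. ennreal (exp (- (x \<bullet> (A *v x)))) \<partial>lborel)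
      = ennreal \<bar>det M\<bar> * (\<integral>\<^sup>+y. ennreal (exp (- ((M *v y) \<bullet> (A *v (M *v y))))) \<partial>lborel)"
    by (rule nn_integral_linear_change_of_variables[OF _ M])
       (intro measurable_compose[OF _ measurable_ennreal] borel_measurable_continuous_onI
         continuous_intros)
  also have "\<dots> = ennreal \<bar>det M\<bar> * ennreal (sqrt (pi ^ CARD('n) / det (transpose M ** A ** M)))"
    unfolding inner_matrix_vector_congruence by (simp add: nn_integral_gaussian_diagonal off pos)
  also have "\<dots> = ennreal (sqrt (pi ^ CARD('n) / det A))"
  proof -
    have "det M * det M * (pi ^ CARD('n) / det (transpose M ** A ** M)) = pi ^ CARD('n) / det A"
      using M sym_pos_def_det_pos[OF A] by (simp add: det_congr field_simps)
    then have "\<bar>det M\<bar> * sqrt (pi ^ CARD('n) / det (transpose M ** A ** M)) = sqrt (pi ^ CARD('n) / det A)"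
      by (metis real_sqrt_abs2 real_sqrt_mult)
    then show ?thesis
      by (simp add: ennreal_mult'[symmetric])
  qed
  finally show ?thesis .
qed

lemma nn_integral_gaussian_scaled:
  fixes A :: "real^'n::finite^'n"
  assumes A: "sym_pos_def A" and r: "0 < r"
  shows "(\<integral>\<^sup>+x. ennreal (exp (- ((x - c) \<bullet> (A *v (x - c))) / r)) \<partial>lborel)
    = ennreal (sqrt ((pi * r) ^ CARD('n) / det A))"
proof -
  have "continuous_on UNIV (\<lambda>x. exp (- ((x - c) \<bullet> (A *v (x - c)) / r)))"
    using r by (intro continuous_intros) auto
  then have [measurable]: "(\<lambda>x. exp (- ((x - c) \<bullet> (A *v (x - c)) / r))) \<in> borel_measurable borel"
    by (rule borel_measurable_continuous_onI)
  have "(\<integral>\<^sup>+x. ennreal (exp (- ((x - c) \<bullet> (A *v (x - c))) / r)) \<partial>lborel)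
      = (\<integral>\<^sup>+x. ennreal (exp (- ((x - c) \<bullet> (A *v (x - c))) / r)) \<partial>distr lborel borel ((+) c))"
    by (simp add: lborel_distr_plus)
  also have "\<dots> = (\<integral>\<^sup>+x. ennreal (exp (- (x \<bullet> (((1 / r) *\<^sub>R A) *v x)))) \<partial>lborel)"
    by (subst nn_integral_distr) (simp_all add: scaleR_matrix_vector_assoc[symmetric])
  also have "\<dots> = ennreal (sqrt (pi ^ CARD('n) / det ((1 / r) *\<^sub>R A)))"
    using A r by (simp add: nn_integral_gaussian sym_pos_def_scaleR)
  also have "pi ^ CARD('n) / det ((1 / r) *\<^sub>R A) = (pi * r) ^ CARD('n) / det A"
    using r by (simp add: det_scaleR power_mult_distrib power_one_over field_simps)
  finally show ?thesis .
qed

section \<open>The covariance for a fixed range parameter\<close>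

lemma normal_dens_scaled:
  fixes Lam :: "real^'n::finite^'n"
  assumes Lam: "sym_pos_def Lam" and r: "0 < r"
  shows "normal_dens m ((r / 2) *\<^sub>R Lam) v
    = exp (- ((v - m) \<bullet> (matrix_inv Lam *v (v - m))) / r) / sqrt ((pi * r) ^ CARD('n) * det Lam)"
proof -
  have "Lam ** matrix_inv Lam = mat 1"
    using matrix_inv_invertible[OF sym_pos_def_invertible[OF Lam]] by blast
  then have "matrix_inv ((r / 2) *\<^sub>R Lam) = (2 / r) *\<^sub>R matrix_inv Lam"
    using r by (intro matrix_inv_unique) (simp add: matrix_scalar_ac scalar_matrix_assoc[symmetric])
  moreover have "(2 * pi) ^ CARD('n) * det ((r / 2) *\<^sub>R Lam) = (pi * r) ^ CARD('n) * det Lam"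
  proof -
    have "(2 * pi) ^ CARD('n) * (r / 2) ^ CARD('n) = (pi * r) ^ CARD('n)"
      by (subst power_mult_distrib[symmetric]) simp
    then show ?thesis
      unfolding det_scaleR by (simp only: mult.assoc[symmetric])
  qed
  ultimately show ?thesis
    using r by (simp add: normal_dens_def scaleR_matrix_vector_assoc[symmetric])
qed

lemma matrix_diff_ldistrib:
  fixes A B C :: "real^'n::finite^'n"
  shows "A ** (B - C) = A ** B - A ** C"
  using matrix_add_ldistrib[of A "B - C" C] by (simp add: eq_diff_eq)

lemma matrix_mul_matrix_inv_add_scaleR:
  fixes Lam :: "real^'n::finite^'n"
  assumes "invertible Lam"
  shows "Lam ** (matrix_inv Lam + c *\<^sub>R mat 1) = c *\<^sub>R Lam + mat 1"
  using matrix_inv_invertible[OF assms]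
  by (simp add: matrix_add_ldistrib matrix_scalar_ac add.commute)

lemma matrix_inv_scaleR_add_mat_1:
  fixes Lam :: "real^'n::finite^'n"
  assumes "invertible Lam" and "invertible (matrix_inv Lam + c *\<^sub>R mat 1)"
  shows "matrix_inv (c *\<^sub>R Lam + mat 1) = mat 1 - c *\<^sub>R matrix_inv (matrix_inv Lam + c *\<^sub>R mat 1)"
proof (rule matrix_inv_unique)
  define B where "B = matrix_inv Lam + c *\<^sub>R mat 1"
  have LB: "Lam ** B = c *\<^sub>R Lam + mat 1"
    unfolding B_def by (rule matrix_mul_matrix_inv_add_scaleR[OF assms(1)])
  have BB: "B ** matrix_inv B = mat 1"
    using matrix_inv_invertible[OF assms(2)] by (simp add: B_def)
  have "(c *\<^sub>R Lam + mat 1) ** (mat 1 - c *\<^sub>R matrix_inv B)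
      = Lam ** B - c *\<^sub>R (Lam ** (B ** matrix_inv B))"
    unfolding LB[symmetric]
    by (simp add: matrix_diff_ldistrib matrix_scalar_ac matrix_mul_assoc scalar_matrix_assoc)
  also have "\<dots> = mat 1"
    by (simp add: BB LB)
  finally show "(c *\<^sub>R Lam + mat 1) ** (mat 1 - c *\<^sub>R matrix_inv (matrix_inv Lam + c *\<^sub>R mat 1))
      = mat 1"
    by (simp add: B_def)
qed

lemma complete_square_quadratic:
  fixes P Bi :: "real^'n::finite^'n" and m w :: "real^'n" and u :: real
  defines "B \<equiv> P + u\<^sup>2 *\<^sub>R mat 1"
  defines "c \<equiv> u *\<^sub>R (Bi *v m)"
  assumes symP: "transpose P = P" and inv: "B ** Bi = mat 1"
  shows "(norm (m - u *\<^sub>R w))\<^sup>2 + w \<bullet> (P *v w)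
    = (w - c) \<bullet> (B *v (w - c)) + m \<bullet> ((mat 1 - u\<^sup>2 *\<^sub>R Bi) *v m)"
proof -
  have symB: "transpose B = B"
    using symP by (simp add: B_def transpose_add transpose_scalar)
  have Bw: "w \<bullet> (B *v w) = u\<^sup>2 * (w \<bullet> w) + w \<bullet> (P *v w)"
    by (simp add: B_def matrix_vector_mult_add_rdistrib scaleR_matrix_vector_assoc[symmetric]
        inner_add_right)
  have Bc: "B *v c = u *\<^sub>R m"
    using inv by (simp add: c_def matrix_vector_mul_assoc matrix_vector_mult_scaleR)
  have cBc: "c \<bullet> (B *v c) = u\<^sup>2 * (m \<bullet> (Bi *v m))"
    unfolding Bc by (simp add: c_def power2_eq_square inner_commute)
  have wBc: "w \<bullet> (B *v c) = u * (w \<bullet> m)"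
    by (simp add: Bc)
  have "(w - c) \<bullet> (B *v (w - c)) = w \<bullet> (B *v w) - c \<bullet> (B *v w) - w \<bullet> (B *v c) + c \<bullet> (B *v c)"
    by (simp add: matrix_vector_mult_diff_distrib inner_diff_left inner_diff_right)
  also have "\<dots> = w \<bullet> (B *v w) - 2 * (w \<bullet> (B *v c)) + c \<bullet> (B *v c)"
    using inner_matrix_vector_sym[OF symB, of c w] by linarith
  also have "\<dots> = u\<^sup>2 * (w \<bullet> w) + w \<bullet> (P *v w) - 2 * u * (w \<bullet> m) + u\<^sup>2 * (m \<bullet> (Bi *v m))"
    unfolding Bw wBc cBc by simp
  finally have rhs: "(w - c) \<bullet> (B *v (w - c))
      = u\<^sup>2 * (w \<bullet> w) + w \<bullet> (P *v w) - 2 * u * (w \<bullet> m) + u\<^sup>2 * (m \<bullet> (Bi *v m))" .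
  have lhs: "(norm (m - u *\<^sub>R w))\<^sup>2 = m \<bullet> m - 2 * u * (w \<bullet> m) + u\<^sup>2 * (w \<bullet> w)"
    by (simp add: power2_norm_eq_inner inner_diff_left inner_diff_right inner_commute[of m w])
       (simp add: power2_eq_square algebra_simps)
  have "m \<bullet> ((mat 1 - u\<^sup>2 *\<^sub>R Bi) *v m) = m \<bullet> m - u\<^sup>2 * (m \<bullet> (Bi *v m))"
    by (simp add: matrix_vector_mult_diff_rdistrib scaleR_matrix_vector_assoc[symmetric]
        inner_diff_right)
  then show ?thesis
    unfolding lhs rhs by linarith
qed

lemma Cs_mult_normal_dens:
  fixes lam h v :: "real^'n::finite" and Lam :: "real^'n^'n" and u :: real
  defines "B \<equiv> matrix_inv Lam + u\<^sup>2 *\<^sub>R mat 1"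
  defines "\<mu> \<equiv> lam + u *\<^sub>R (matrix_inv B *v (h - u *\<^sub>R lam))"
  assumes Lam: "sym_pos_def Lam" and r: "0 < r"
  shows "Cs \<sigma>2 (h - u *\<^sub>R v) (sqrt r) * normal_dens lam (((sqrt r)\<^sup>2 / 2) *\<^sub>R Lam) v
    = \<sigma>2 * exp (- ((h - u *\<^sub>R lam) \<bullet> (matrix_inv (u\<^sup>2 *\<^sub>R Lam + mat 1) *v (h - u *\<^sub>R lam))) / r)
      / sqrt ((pi * r) ^ CARD('n) * det Lam) * exp (- ((v - \<mu>) \<bullet> (B *v (v - \<mu>))) / r)"
proof -
  define m where "m = h - u *\<^sub>R lam"
  define K where "K = m \<bullet> (matrix_inv (u\<^sup>2 *\<^sub>R Lam + mat 1) *v m)"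
  have P: "sym_pos_def (matrix_inv Lam)"
    by (rule sym_pos_def_matrix_inv[OF Lam])
  have B: "sym_pos_def B"
    unfolding B_def by (intro sym_pos_def_add_scaleR P sym_pos_def_mat_1) simp
  have "B ** matrix_inv B = mat 1"
    using matrix_inv_invertible[OF sym_pos_def_invertible[OF B]] by blast
  moreover have "K = m \<bullet> ((mat 1 - u\<^sup>2 *\<^sub>R matrix_inv B) *v m)"
    using matrix_inv_scaleR_add_mat_1[OF sym_pos_def_invertible[OF Lam], of "u\<^sup>2"]
      sym_pos_def_invertible[OF B]
    by (simp add: K_def B_def)
  ultimately have "(norm (m - u *\<^sub>R (v - lam)))\<^sup>2 + (v - lam) \<bullet> (matrix_inv Lam *v (v - lam))
      = (v - lam - u *\<^sub>R (matrix_inv B *v m)) \<bullet> (B *v (v - lam - u *\<^sub>R (matrix_inv B *v m))) + K"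
    using complete_square_quadratic[of "matrix_inv Lam" u "matrix_inv B" m "v - lam"] P
    by (simp add: B_def sym_pos_def_def)
  moreover have "m - u *\<^sub>R (v - lam) = h - u *\<^sub>R v" and "v - lam - u *\<^sub>R (matrix_inv B *v m) = v - \<mu>"
    by (simp_all add: m_def \<mu>_def algebra_simps)
  ultimately have "(norm (h - u *\<^sub>R v))\<^sup>2 + (v - lam) \<bullet> (matrix_inv Lam *v (v - lam))
      = (v - \<mu>) \<bullet> (B *v (v - \<mu>)) + K"
    by simp
  then have "Cs \<sigma>2 (h - u *\<^sub>R v) (sqrt r) * normal_dens lam (((sqrt r)\<^sup>2 / 2) *\<^sub>R Lam) v
      = \<sigma>2 * exp (- K / r) / sqrt ((pi * r) ^ CARD('n) * det Lam) * exp (- ((v - \<mu>) \<bullet> (B *v (v - \<mu>))) / r)"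
    using r by (simp add: Cs_def normal_dens_scaled[OF Lam r] exp_add[symmetric] field_simps)
  then show ?thesis
    by (simp only: K_def m_def)
qed

lemma det_mat_1_add_scaleR:
  fixes Lam :: "real^'n::finite^'n"
  assumes "invertible Lam"
  shows "det (mat 1 + c *\<^sub>R Lam) = det Lam * det (matrix_inv Lam + c *\<^sub>R mat 1)"
  by (metis add.commute det_mul matrix_mul_matrix_inv_add_scaleR[OF assms])

lemma Clag_sqrt_eq:
  fixes lam h :: "real^'n::finite" and Lam :: "real^'n^'n"
  assumes Lam: "sym_pos_def Lam" and r: "0 < r"
  shows "Clag \<sigma>2 lam Lam h u (sqrt r) = \<sigma>2 * det (mat 1 + u\<^sup>2 *\<^sub>R Lam) powr (- 1 / 2) *
    exp (- ((h - u *\<^sub>R lam) \<bullet> (matrix_inv (u\<^sup>2 *\<^sub>R Lam + mat 1) *v (h - u *\<^sub>R lam))) / r)"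
proof -
  define B where "B = matrix_inv Lam + u\<^sup>2 *\<^sub>R mat 1"
  define \<mu> where "\<mu> = lam + u *\<^sub>R (matrix_inv B *v (h - u *\<^sub>R lam))"
  define E where "E = exp (- ((h - u *\<^sub>R lam) \<bullet> (matrix_inv (u\<^sup>2 *\<^sub>R Lam + mat 1) *v (h - u *\<^sub>R lam))) / r)"
  define N where "N = sqrt ((pi * r) ^ CARD('n) * det Lam)"
  have B: "sym_pos_def B"
    unfolding B_def by (intro sym_pos_def_add_scaleR sym_pos_def_matrix_inv Lam sym_pos_def_mat_1) simp
  have "continuous_on UNIV (\<lambda>v. exp (- ((v - \<mu>) \<bullet> (B *v (v - \<mu>)) / r)))"
    using r by (intro continuous_intros) auto
  then have [measurable]: "(\<lambda>v. exp (- ((v - \<mu>) \<bullet> (B *v (v - \<mu>)) / r))) \<in> borel_measurable borel"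
    by (rule borel_measurable_continuous_onI)
  have "Clag \<sigma>2 lam Lam h u (sqrt r)
      = \<sigma>2 * E / N * (LINT v|lborel. exp (- ((v - \<mu>) \<bullet> (B *v (v - \<mu>))) / r))"
    using Cs_mult_normal_dens[OF Lam r] by (simp add: Clag_def B_def \<mu>_def E_def N_def)
  also have "(LINT v|lborel. exp (- ((v - \<mu>) \<bullet> (B *v (v - \<mu>))) / r)) = sqrt ((pi * r) ^ CARD('n) / det B)"
    using nn_integral_gaussian_scaled[OF B r, of \<mu>] sym_pos_def_det_pos[OF B] r
    by (subst integral_eq_nn_integral) simp_all
  also have "\<sigma>2 * E / N * sqrt ((pi * r) ^ CARD('n) / det B)
      = \<sigma>2 * det (mat 1 + u\<^sup>2 *\<^sub>R Lam) powr (- 1 / 2) * E"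
  proof -
    have "sqrt ((pi * r) ^ CARD('n) / det B) / N = 1 / sqrt (det Lam * det B)"
      using r sym_pos_def_det_pos[OF Lam] sym_pos_def_det_pos[OF B]
      by (simp add: N_def real_sqrt_divide real_sqrt_mult)
    also have "\<dots> = det (mat 1 + u\<^sup>2 *\<^sub>R Lam) powr (- 1 / 2)"
      using sym_pos_def_det_pos[OF Lam] sym_pos_def_det_pos[OF B]
      by (simp add: B_def det_mat_1_add_scaleR[OF sym_pos_def_invertible[OF Lam]]
          powr_minus_divide powr_half_sqrt[symmetric])
    finally have "sqrt ((pi * r) ^ CARD('n) / det B) / N = det (mat 1 + u\<^sup>2 *\<^sub>R Lam) powr (- 1 / 2)" .
    moreover have "\<sigma>2 * E / N * sqrt ((pi * r) ^ CARD('n) / det B)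
        = \<sigma>2 * (sqrt ((pi * r) ^ CARD('n) / det B) / N) * E"
      by simp
    ultimately show ?thesis
      by simp
  qed
  finally show ?thesis
    by (simp add: E_def)
qed

section \<open>Gamma and inverse gamma integrals\<close>

lemma has_integral_Gamma_open:
  fixes a :: real
  assumes a: "0 < a"
  shows "((\<lambda>t. t powr (a - 1) / exp t) has_integral Gamma a) {0<..}"
proof -
  have "((\<lambda>t. t powr (a - 1) / exp t) has_integral Gamma a) {0..}"
    using Gamma_integral_real[OF a] .
  moreover have "{x \<in> {0..} - {0<..}. x powr (a - 1) / exp x \<noteq> (0::real)} = {}"
    and "{x \<in> {0<..} - {0..}. x powr (a - 1) / exp x \<noteq> (0::real)} = {}"
    by auto
  ultimately show ?thesis
    using has_integral_spike_set_eq[where f = "\<lambda>x. x powr (a - 1) / exp x" and S = "{0..}"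
        and T = "{0<..}" and y = "Gamma a"]
    by (simp only: negligible_empty)
qed

lemma has_integral_Gamma_kernel:
  fixes a c :: real
  assumes a: "0 < a" and c: "0 < c"
  shows "((\<lambda>t. t powr (a - 1) * exp (- (c * t))) has_integral Gamma a / c powr a) {0<..}"
proof -
  let ?f = "\<lambda>t::real. t powr (a - 1) / exp t"
  have f: "(?f has_integral Gamma a) {0<..}" using has_integral_Gamma_open[OF a] .
  have fabs: "?f absolutely_integrable_on {0<..}"
    using f by (intro nonnegative_absolutely_integrable_1) (auto simp: has_integral_integrable)
  have img: "(\<lambda>t. c * t) ` {0<..} = {0<..}"
  proof
    show "{0<..} \<subseteq> (\<lambda>t. c * t) ` {0<..}"
    proof
      fix x :: real assume "x \<in> {0<..}"
      then show "x \<in> (\<lambda>t. c * t) ` {0<..}" using c by (intro image_eqI[of _ _ "x / c"]) auto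
    qed
  qed (use c in auto)
  have "(\<lambda>t. \<bar>c\<bar> * ?f (c * t)) absolutely_integrable_on {0<..} \<and>
        integral {0<..} (\<lambda>t. \<bar>c\<bar> * ?f (c * t)) = Gamma a"
    using has_absolute_integral_change_of_variables_1'[of "{0<..}" "\<lambda>t. c * t" "\<lambda>_. c" ?f "Gamma a"]
      fabs f c img
    by (auto intro!: derivative_eq_intros simp: inj_on_def integral_unique)
  then have "((\<lambda>t. \<bar>c\<bar> * ?f (c * t)) has_integral Gamma a) {0<..}"
    using has_integral_integral set_lebesgue_integral_eq_integral(1) by metis
  then have "((\<lambda>t. (1 / c powr a) * (\<bar>c\<bar> * ?f (c * t))) has_integral (1 / c powr a) * Gamma a) {0<..}"
    by (rule has_integral_mult_right)
  moreover have "(1 / c powr a) * (\<bar>c\<bar> * ?f (c * t)) = t powr (a - 1) * exp (- (c * t))" if "t \<in> {0<..}" for t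
  proof -
    have "(c * t) powr (a - 1) = c powr (a - 1) * t powr (a - 1)" using c that by (simp add: powr_mult)
    moreover have "c * c powr (a - 1) = c powr a" using c by (simp add: powr_diff powr_one)
    ultimately show ?thesis using c that by (simp add: exp_minus field_simps)
  qed
  ultimately show ?thesis
    by (subst (asm) has_integral_cong) (auto simp: field_simps)
qed

lemma has_integral_inverse_Gamma_kernel:
  fixes a c :: real
  assumes a: "0 < a" and c: "0 < c"
  shows "((\<lambda>x. x powr (- a - 1) * exp (- (c / x))) has_integral Gamma a / c powr a) {0<..}"
proof -
  let ?f = "\<lambda>x::real. x powr (- a - 1) * exp (- (c / x))"
  let ?h = "\<lambda>t::real. \<bar>- 1 / t\<^sup>2\<bar> * ?f (1 / t)"
  have heq: "?h t = t powr (a - 1) * exp (- (c * t))" if "t \<in> {0<..}" for t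
  proof -
    have t: "t > 0" using that by simp
    have "(1 / t) powr (- a - 1) = t powr (a + 1)"
    proof -
      have e: "- a - 1 = - (a + 1)" by simp
      show ?thesis using t unfolding e powr_minus_divide by (simp add: powr_divide)
    qed
    moreover have "t powr (a + 1) = t powr (a - 1) * t\<^sup>2"
    proof -
      have "t powr (a + 1) = t powr ((a - 1) + 2)" by (simp add: add.commute)
      also have "\<dots> = t powr (a - 1) * t powr 2" by (rule powr_add)
      also have "t powr 2 = t\<^sup>2" using t by (simp add: powr_numeral)
      finally show ?thesis .
    qed
    ultimately show ?thesis using t by (simp add: field_simps)
  qed
  have h: "(?h has_integral Gamma a / c powr a) {0<..}"
    by (rule has_integral_eq[OF _ has_integral_Gamma_kernel[OF a c]]) (rule heq[symmetric])
  have habs: "?h absolutely_integrable_on {0<..}"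
    using h by (intro nonnegative_absolutely_integrable_1) (auto simp: has_integral_integrable)
  have img: "(\<lambda>t. 1 / t) ` {0<..} = ({0<..} :: real set)"
  proof
    show "{0<..} \<subseteq> (\<lambda>t. 1 / t) ` ({0<..} :: real set)"
    proof
      fix x :: real assume "x \<in> {0<..}"
      then show "x \<in> (\<lambda>t. 1 / t) ` {0<..}" by (intro image_eqI[of _ _ "1 / x"]) auto
    qed
  qed auto
  have der: "((\<lambda>t. 1 / t) has_field_derivative (- 1 / t\<^sup>2)) (at t within {0<..})" if "t \<in> {0<..}" for t :: real
  proof -
    have t: "t \<noteq> 0" using that by simp
    have "((\<lambda>t. 1 / t) has_field_derivative (- 1 / t\<^sup>2)) (at t)"
      by (rule derivative_eq_intros refl | use t in \<open>simp add: power2_eq_square\<close>)+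
    then show ?thesis by (rule has_field_derivative_at_within)
  qed
  have inj: "inj_on (\<lambda>t::real. 1 / t) {0<..}" by (auto simp: inj_on_def)
  have "?f absolutely_integrable_on {0<..} \<and> integral {0<..} ?f = Gamma a / c powr a"
    using has_absolute_integral_change_of_variables_1'[of "{0<..}" "\<lambda>t. 1 / t" "\<lambda>t. - 1 / t\<^sup>2" ?f "Gamma a / c powr a"]
      habs h der inj img by (auto simp: integral_unique)
  then show ?thesis
    using has_integral_integral set_lebesgue_integral_eq_integral(1) by metis
qed

lemma nn_integral_Gamma_kernel:
  fixes a c :: real
  assumes a: "0 < a" and c: "0 < c"
  shows "(\<integral>\<^sup>+t. ennreal (t powr (a - 1) * exp (- (c * t))) * indicator {0<..} t \<partial>lborel)
    = ennreal (Gamma a / c powr a)"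
  by (rule nn_integral_has_integral_lebesgue'[OF _ has_integral_Gamma_kernel[OF a c]]) auto

lemma nn_integral_inverse_Gamma_kernel:
  fixes a c :: real
  assumes a: "0 < a" and c: "0 < c"
  shows "(\<integral>\<^sup>+x. ennreal (x powr (- a - 1) * exp (- (c / x))) * indicator {0<..} x \<partial>lborel)
    = ennreal (Gamma a / c powr a)"
  by (rule nn_integral_has_integral_lebesgue'[OF _ has_integral_inverse_Gamma_kernel[OF a c]]) auto

lemma gamma_dens_nonneg: "0 < a \<Longrightarrow> 0 \<le> gamma_dens a b x"
  by (simp add: gamma_dens_def Gamma_real_pos)

lemma invgamma_dens_nonneg: "0 < a \<Longrightarrow> 0 \<le> invgamma_dens a b x"
  by (simp add: invgamma_dens_def Gamma_real_pos)

lemma borel_measurable_gamma_dens [measurable]: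
  assumes [measurable]: "b \<in> borel_measurable M" "x \<in> borel_measurable M"
  shows "(\<lambda>\<omega>. gamma_dens a (b \<omega>) (x \<omega>)) \<in> borel_measurable M"
  unfolding gamma_dens_def by measurable

lemma borel_measurable_invgamma_dens [measurable]:
  assumes [measurable]: "b \<in> borel_measurable M" "x \<in> borel_measurable M"
  shows "(\<lambda>\<omega>. invgamma_dens a (b \<omega>) (x \<omega>)) \<in> borel_measurable M"
  unfolding invgamma_dens_def by measurable

lemma gamma_dens_rescale:
  assumes "0 < b"
  shows "gamma_dens a b (y / b) / b = gamma_dens a 1 y"
proof (cases "0 < y")
  case True
  have "(y / b) powr (a - 1) = y powr (a - 1) / b powr (a - 1)"
    using True assms by (simp add: powr_divide)
  moreover have "b powr a = b * b powr (a - 1)"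
    using assms by (simp add: powr_diff)
  ultimately have "b powr a * (y / b) powr (a - 1) = b * y powr (a - 1)"
    using assms by simp
  then show ?thesis
    using True assms by (simp add: gamma_dens_def)
qed (use assms in \<open>auto simp: gamma_dens_def zero_less_divide_iff\<close>)

lemma nn_integral_gamma_dens_rescale:
  fixes f :: "real \<Rightarrow> ennreal"
  assumes b: "0 < b" and a: "0 < a" and [measurable]: "f \<in> borel_measurable borel"
  shows "(\<integral>\<^sup>+r. ennreal (gamma_dens a b r) * f r \<partial>lborel)
    = (\<integral>\<^sup>+y. ennreal (gamma_dens a 1 y) * f (y / b) \<partial>lborel)"
proof -
  have "(\<integral>\<^sup>+r. ennreal (gamma_dens a b r) * f r \<partial>lborel)
      = ennreal (1 / b) * (\<integral>\<^sup>+y. ennreal (gamma_dens a b (y / b)) * f (y / b) \<partial>lborel)"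
    using b by (subst nn_integral_real_affine[where c = "1 / b" and t = 0]) simp_all
  also have "\<dots> = (\<integral>\<^sup>+y. ennreal (1 / b) * (ennreal (gamma_dens a b (y / b)) * f (y / b)) \<partial>lborel)"
    by (rule nn_integral_cmult[symmetric]) measurable
  also have "\<dots> = (\<integral>\<^sup>+y. ennreal (gamma_dens a b (y / b) / b) * f (y / b) \<partial>lborel)"
    using a b by (intro nn_integral_cong)
      (simp add: ennreal_mult[symmetric] gamma_dens_nonneg mult.assoc[symmetric])
  finally show ?thesis
    by (simp add: gamma_dens_rescale[OF b])
qed

lemma nn_integral_gamma_dens:
  assumes "0 < a" and "0 < b"
  shows "(\<integral>\<^sup>+x. ennreal (gamma_dens a b x) \<partial>lborel) = 1"
proof -
  have G: "0 < Gamma a" "Gamma a \<noteq> 0"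
    using Gamma_real_pos[OF assms(1)] by simp_all
  have "(\<integral>\<^sup>+x. ennreal (gamma_dens a b x) \<partial>lborel)
      = (\<integral>\<^sup>+x. ennreal (b powr a / Gamma a) *
          (ennreal (x powr (a - 1) * exp (- (b * x))) * indicator {0<..} x) \<partial>lborel)"
    using assms G by (intro nn_integral_cong)
      (auto simp: gamma_dens_def ennreal_mult'[symmetric] indicator_def)
  also have "\<dots> = ennreal (b powr a / Gamma a) * ennreal (Gamma a / b powr a)"
    using assms by (subst nn_integral_cmult) (simp_all add: nn_integral_Gamma_kernel)
  also have "\<dots> = 1"
    using assms G by (simp add: ennreal_mult[symmetric])
  finally show ?thesis .
qed

lemma nn_integral_invgamma_dens_exp:
  assumes a: "0 < a" and b: "0 < b" and c: "0 \<le> c"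
  shows "(\<integral>\<^sup>+p. ennreal (invgamma_dens a b p * exp (- c / p)) \<partial>lborel) = ennreal ((b / (b + c)) powr a)"
proof -
  have G: "0 < Gamma a" "Gamma a \<noteq> 0"
    using Gamma_real_pos[OF a] by simp_all
  have "(\<integral>\<^sup>+p. ennreal (invgamma_dens a b p * exp (- c / p)) \<partial>lborel)
      = (\<integral>\<^sup>+p. ennreal (b powr a / Gamma a) *
          (ennreal (p powr (- a - 1) * exp (- ((b + c) / p))) * indicator {0<..} p) \<partial>lborel)"
  proof (intro nn_integral_cong)
    fix p :: real
    have "exp (- b / p) * exp (- c / p) = exp (- ((b + c) / p))"
      by (simp add: exp_add[symmetric] add_divide_distrib)
    then show "ennreal (invgamma_dens a b p * exp (- c / p))
        = ennreal (b powr a / Gamma a) * (ennreal (p powr (- a - 1) * exp (- ((b + c) / p))) *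
          indicator {0<..} p)"
      using a b G by (auto simp: invgamma_dens_def ennreal_mult'[symmetric] mult_ac)
  qed
  also have "\<dots> = ennreal (b powr a / Gamma a) * ennreal (Gamma a / (b + c) powr a)"
    using b c by (subst nn_integral_cmult) (simp_all add: nn_integral_inverse_Gamma_kernel[OF a])
  also have "\<dots> = ennreal (b powr a / Gamma a * (Gamma a / (b + c) powr a))"
    using a b c G by (simp add: ennreal_mult[symmetric])
  also have "b powr a / Gamma a * (Gamma a / (b + c) powr a) = (b / (b + c)) powr a"
    using a b c G by (simp add: powr_divide)
  finally show ?thesis .
qed

section \<open>The mixture over the range parameter\<close>

definition CH_gamma_mixture :: "real \<Rightarrow> real \<Rightarrow> real \<Rightarrow> ennreal" where
  "CH_gamma_mixture \<nu> \<alpha> s = (\<integral>\<^sup>+y. ennreal (gamma_dens \<nu> 1 y * (y / (y + s)) powr \<alpha>) \<partial>lborel)"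

lemma CH_gamma_mixture_0:
  assumes "0 < \<nu>"
  shows "CH_gamma_mixture \<nu> \<alpha> 0 = 1"
proof -
  have "CH_gamma_mixture \<nu> \<alpha> 0 = (\<integral>\<^sup>+y. ennreal (gamma_dens \<nu> 1 y) \<partial>lborel)"
    unfolding CH_gamma_mixture_def by (intro nn_integral_cong) (simp add: gamma_dens_def)
  then show ?thesis
    using nn_integral_gamma_dens[OF assms zero_less_one] by simp
qed

lemma set_integral_eq_nn_integral:
  fixes f :: "real \<Rightarrow> real"
  assumes [measurable]: "f \<in> borel_measurable borel" "A \<in> sets borel"
    and nonneg: "\<And>x. x \<in> A \<Longrightarrow> 0 \<le> f x"
  shows "(LINT x:A|lborel. f x) = enn2real (\<integral>\<^sup>+x. ennreal (f x) * indicator A x \<partial>lborel)"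
proof -
  have "(LINT x:A|lborel. f x) = enn2real (\<integral>\<^sup>+x. ennreal (indicator A x *\<^sub>R f x) \<partial>lborel)"
    unfolding set_lebesgue_integral_def using nonneg
    by (intro integral_eq_nn_integral) (auto simp: indicator_def)
  also have "(\<integral>\<^sup>+x. ennreal (indicator A x *\<^sub>R f x) \<partial>lborel)
      = (\<integral>\<^sup>+x. ennreal (f x) * indicator A x \<partial>lborel)"
    by (intro nn_integral_cong) (auto simp: indicator_def)
  finally show ?thesis .
qed

lemma nn_integral_hypU_integrand_dy:
  assumes "0 < \<nu> + \<alpha>" and "0 < t"
  shows "(\<integral>\<^sup>+y. ennreal (t powr (\<alpha> - 1) * y powr (\<nu> + \<alpha> - 1) * exp (- (s * t) - (1 + t) * y)) *
      indicator {0<..} y \<partial>lborel)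
    = ennreal (Gamma (\<nu> + \<alpha>)) * ennreal (t powr (\<alpha> - 1) * (1 + t) powr (- \<nu> - \<alpha>) * exp (- s * t))"
proof -
  have "ennreal (t powr (\<alpha> - 1) * y powr (\<nu> + \<alpha> - 1) * exp (- (s * t) - (1 + t) * y)) * indicator {0<..} y
      = ennreal (t powr (\<alpha> - 1) * exp (- (s * t))) *
        (ennreal (y powr (\<nu> + \<alpha> - 1) * exp (- ((1 + t) * y))) * indicator {0<..} y)" for y
    by (simp add: exp_diff exp_minus exp_add ennreal_mult[symmetric] field_simps)
  then have "(\<integral>\<^sup>+y. ennreal (t powr (\<alpha> - 1) * y powr (\<nu> + \<alpha> - 1) * exp (- (s * t) - (1 + t) * y)) *
      indicator {0<..} y \<partial>lborel)
      = ennreal (t powr (\<alpha> - 1) * exp (- (s * t))) * ennreal (Gamma (\<nu> + \<alpha>) / (1 + t) powr (\<nu> + \<alpha>))"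
    using assms by (simp add: nn_integral_cmult nn_integral_Gamma_kernel)
  also have "\<dots> = ennreal (Gamma (\<nu> + \<alpha>)) * ennreal (t powr (\<alpha> - 1) * (1 + t) powr (- \<nu> - \<alpha>) * exp (- s * t))"
  proof -
    have "(1 + t) powr (- \<nu> - \<alpha>) = 1 / (1 + t) powr (\<nu> + \<alpha>)"
      using assms by (simp add: powr_minus_divide[symmetric])
    then show ?thesis
      using assms Gamma_real_pos[OF assms(1)] by (simp add: ennreal_mult[symmetric])
  qed
  finally show ?thesis .
qed

lemma nn_integral_hypU_integrand_dt:
  assumes \<nu>: "0 < \<nu>" and \<alpha>: "0 < \<alpha>" and s: "0 \<le> s" and y: "0 < y"
  shows "(\<integral>\<^sup>+t. ennreal (t powr (\<alpha> - 1) * y powr (\<nu> + \<alpha> - 1) * exp (- (s * t) - (1 + t) * y)) *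
      indicator {0<..} t \<partial>lborel)
    = ennreal (Gamma \<nu> * Gamma \<alpha>) * ennreal (gamma_dens \<nu> 1 y * (y / (y + s)) powr \<alpha>)"
proof -
  have "ennreal (t powr (\<alpha> - 1) * y powr (\<nu> + \<alpha> - 1) * exp (- (s * t) - (1 + t) * y)) * indicator {0<..} t
      = ennreal (y powr (\<nu> + \<alpha> - 1) * exp (- y)) *
        (ennreal (t powr (\<alpha> - 1) * exp (- ((y + s) * t))) * indicator {0<..} t)" for t
  proof -
    have "- (s * t) - (1 + t) * y = - y - (y + s) * t"
      by (simp add: algebra_simps)
    then show ?thesis
      by (simp add: exp_diff exp_minus exp_add ennreal_mult[symmetric] field_simps)
  qed
  then have "(\<integral>\<^sup>+t. ennreal (t powr (\<alpha> - 1) * y powr (\<nu> + \<alpha> - 1) * exp (- (s * t) - (1 + t) * y)) *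
      indicator {0<..} t \<partial>lborel)
      = ennreal (y powr (\<nu> + \<alpha> - 1) * exp (- y)) * ennreal (Gamma \<alpha> / (y + s) powr \<alpha>)"
    using \<alpha> s y by (simp add: nn_integral_cmult nn_integral_Gamma_kernel)
  also have "\<dots> = ennreal (Gamma \<nu> * Gamma \<alpha>) * ennreal (gamma_dens \<nu> 1 y * (y / (y + s)) powr \<alpha>)"
    using s y Gamma_real_pos[OF \<nu>] Gamma_real_pos[OF \<alpha>]
    by (simp add: ennreal_mult[symmetric] gamma_dens_def powr_add[symmetric] powr_divide field_simps)
  finally show ?thesis .
qed

text \<open>Both sides equal the double integral of
  \<open>t\<^sup>\<alpha>\<^sup>-\<^sup>1 y\<^sup>\<nu>\<^sup>+\<^sup>\<alpha>\<^sup>-\<^sup>1 exp (- s t - (1 + t) y)\<close> over \<open>t, y > 0\<close>,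
  integrated first in \<open>y\<close> and first in \<open>t\<close> respectively.\<close>

lemma Gamma_nn_integral_hypU_kernel:
  assumes \<nu>: "0 < \<nu>" and \<alpha>: "0 < \<alpha>" and s: "0 \<le> s"
  shows "ennreal (Gamma (\<nu> + \<alpha>)) *
      (\<integral>\<^sup>+t. ennreal (t powr (\<alpha> - 1) * (1 + t) powr (- \<nu> - \<alpha>) * exp (- s * t)) * indicator {0<..} t \<partial>lborel)
    = ennreal (Gamma \<nu> * Gamma \<alpha>) * CH_gamma_mixture \<nu> \<alpha> s"
proof -
  define H where "H t y = ennreal (t powr (\<alpha> - 1) * y powr (\<nu> + \<alpha> - 1) * exp (- (s * t) - (1 + t) * y)) *
      indicator {0<..} t * indicator {0<..} y" for t y :: real
  have Hm [measurable]: "case_prod H \<in> borel_measurable (lborel \<Otimes>\<^sub>M lborel)"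
    unfolding H_def case_prod_beta by measurable
  have "(\<integral>\<^sup>+y. H t y \<partial>lborel) = ennreal (Gamma (\<nu> + \<alpha>)) *
      (ennreal (t powr (\<alpha> - 1) * (1 + t) powr (- \<nu> - \<alpha>) * exp (- s * t)) * indicator {0<..} t)" for t
  proof (cases "0 < t")
    case True
    then show ?thesis
      using nn_integral_hypU_integrand_dy[of \<nu> \<alpha> t s] \<nu> \<alpha> by (simp add: H_def)
  qed (simp add: H_def)
  then have "(\<integral>\<^sup>+t. \<integral>\<^sup>+y. H t y \<partial>lborel \<partial>lborel) = ennreal (Gamma (\<nu> + \<alpha>)) *
      (\<integral>\<^sup>+t. ennreal (t powr (\<alpha> - 1) * (1 + t) powr (- \<nu> - \<alpha>) * exp (- s * t)) * indicator {0<..} t \<partial>lborel)"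
    by (simp add: nn_integral_cmult)
  moreover have "(\<integral>\<^sup>+t. H t y \<partial>lborel)
      = ennreal (Gamma \<nu> * Gamma \<alpha>) * ennreal (gamma_dens \<nu> 1 y * (y / (y + s)) powr \<alpha>)" for y
  proof (cases "0 < y")
    case True
    then show ?thesis
      using nn_integral_hypU_integrand_dt[OF \<nu> \<alpha> s True] by (simp add: H_def)
  qed (simp add: H_def gamma_dens_def)
  then have "(\<integral>\<^sup>+y. \<integral>\<^sup>+t. H t y \<partial>lborel \<partial>lborel) = ennreal (Gamma \<nu> * Gamma \<alpha>) * CH_gamma_mixture \<nu> \<alpha> s"
    by (simp add: nn_integral_cmult CH_gamma_mixture_def)
  ultimately show ?thesis
    using lborel_pair.Fubini'[OF Hm] by simp
qed

lemma CH_eq_CH_gamma_mixture: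
  assumes \<nu>: "0 < \<nu>" and \<alpha>: "0 < \<alpha>"
  shows "CH r \<nu> \<alpha> \<beta> = enn2real (CH_gamma_mixture \<nu> \<alpha> (r\<^sup>2 / \<beta>\<^sup>2))"
proof (cases "r = 0")
  case True
  then show ?thesis
    by (simp add: CH_def CH_gamma_mixture_0[OF \<nu>])
next
  case False
  define s where "s = r\<^sup>2 / \<beta>\<^sup>2"
  have s: "0 \<le> s"
    by (simp add: s_def)
  have G: "0 < Gamma \<nu>" "0 < Gamma \<alpha>" "0 < Gamma (\<nu> + \<alpha>)"
    using \<nu> \<alpha> by (simp_all add: Gamma_real_pos)
  have "CH r \<nu> \<alpha> \<beta> = Gamma (\<nu> + \<alpha>) / (Gamma \<nu> * Gamma \<alpha>) *
      (LINT t:{0<..}|lborel. t powr (\<alpha> - 1) * (1 + t) powr (- \<nu> - \<alpha>) * exp (- s * t))"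
    using False by (simp add: CH_def hypU_def s_def)
  also have "\<dots> = Gamma (\<nu> + \<alpha>) / (Gamma \<nu> * Gamma \<alpha>) * enn2real
      (\<integral>\<^sup>+t. ennreal (t powr (\<alpha> - 1) * (1 + t) powr (- \<nu> - \<alpha>) * exp (- s * t)) * indicator {0<..} t \<partial>lborel)"
    by (subst set_integral_eq_nn_integral) auto
  also have "\<dots> = enn2real (CH_gamma_mixture \<nu> \<alpha> s)"
  proof -
    have "Gamma (\<nu> + \<alpha>) * enn2real
        (\<integral>\<^sup>+t. ennreal (t powr (\<alpha> - 1) * (1 + t) powr (- \<nu> - \<alpha>) * exp (- s * t)) * indicator {0<..} t \<partial>lborel)
        = Gamma \<nu> * Gamma \<alpha> * enn2real (CH_gamma_mixture \<nu> \<alpha> s)"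
      using arg_cong[OF Gamma_nn_integral_hypU_kernel[OF \<nu> \<alpha> s], of enn2real] G
      by (simp add: enn2real_mult)
    then show ?thesis
      using G by (simp add: field_simps)
  qed
  finally show ?thesis
    by (simp add: s_def)
qed

lemma nn_integral_invgamma_gamma_mixture:
  assumes \<nu>: "0 < \<nu>" and \<alpha>: "0 < \<alpha>" and \<beta>: "0 < \<beta>" and q: "0 \<le> q"
  shows "(\<integral>\<^sup>+p. ennreal (invgamma_dens \<alpha> (\<beta>\<^sup>2 / 4) p) *
      (\<integral>\<^sup>+r. ennreal (gamma_dens \<nu> (1 / (4 * p)) r * exp (- q / r)) \<partial>lborel) \<partial>lborel)
    = CH_gamma_mixture \<nu> \<alpha> (q / \<beta>\<^sup>2)"
proof -
  define H where "H p y = ennreal (invgamma_dens \<alpha> (\<beta>\<^sup>2 / 4) p *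
      (gamma_dens \<nu> 1 y * exp (- (q / (4 * y)) / p)))" for p y
  have Hm [measurable]: "case_prod H \<in> borel_measurable (lborel \<Otimes>\<^sub>M lborel)"
    unfolding H_def case_prod_beta by measurable
  have "ennreal (invgamma_dens \<alpha> (\<beta>\<^sup>2 / 4) p) *
      (\<integral>\<^sup>+r. ennreal (gamma_dens \<nu> (1 / (4 * p)) r * exp (- q / r)) \<partial>lborel) = (\<integral>\<^sup>+y. H p y \<partial>lborel)"
    for p
  proof (cases "0 < p")
    case True
    have "(\<integral>\<^sup>+r. ennreal (gamma_dens \<nu> (1 / (4 * p)) r * exp (- q / r)) \<partial>lborel)
        = (\<integral>\<^sup>+y. ennreal (gamma_dens \<nu> 1 y * exp (- (q / (4 * y)) / p)) \<partial>lborel)"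
      using nn_integral_gamma_dens_rescale[of "1 / (4 * p)" \<nu> "\<lambda>r. ennreal (exp (- q / r))"] True \<nu>
      by (simp add: ennreal_mult gamma_dens_nonneg mult_ac)
    then show ?thesis
      unfolding H_def using \<alpha> \<nu>
      by (simp add: nn_integral_cmult[symmetric] ennreal_mult invgamma_dens_nonneg gamma_dens_nonneg
          mult.assoc)
  qed (simp add: H_def invgamma_dens_def)
  then have "(\<integral>\<^sup>+p. ennreal (invgamma_dens \<alpha> (\<beta>\<^sup>2 / 4) p) *
      (\<integral>\<^sup>+r. ennreal (gamma_dens \<nu> (1 / (4 * p)) r * exp (- q / r)) \<partial>lborel) \<partial>lborel)
      = (\<integral>\<^sup>+p. \<integral>\<^sup>+y. H p y \<partial>lborel \<partial>lborel)"
    by simp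
  also have "\<dots> = (\<integral>\<^sup>+y. \<integral>\<^sup>+p. H p y \<partial>lborel \<partial>lborel)"
    by (rule lborel_pair.Fubini'[OF Hm, symmetric])
  also have "\<dots> = CH_gamma_mixture \<nu> \<alpha> (q / \<beta>\<^sup>2)"
    unfolding CH_gamma_mixture_def
  proof (intro nn_integral_cong)
    fix y :: real
    show "(\<integral>\<^sup>+p. H p y \<partial>lborel) = ennreal (gamma_dens \<nu> 1 y * (y / (y + q / \<beta>\<^sup>2)) powr \<alpha>)"
    proof (cases "0 < y")
      case True
      have "H p y = ennreal (gamma_dens \<nu> 1 y) *
          ennreal (invgamma_dens \<alpha> (\<beta>\<^sup>2 / 4) p * exp (- (q / (4 * y)) / p))" for p
        unfolding H_def using \<nu> by (simp add: ennreal_mult'[symmetric] gamma_dens_nonneg mult_ac)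
      then have "(\<integral>\<^sup>+p. H p y \<partial>lborel) = ennreal (gamma_dens \<nu> 1 y) *
          (\<integral>\<^sup>+p. ennreal (invgamma_dens \<alpha> (\<beta>\<^sup>2 / 4) p * exp (- (q / (4 * y)) / p)) \<partial>lborel)"
        by (simp add: nn_integral_cmult)
      also have "\<dots> = ennreal (gamma_dens \<nu> 1 y) * ennreal ((\<beta>\<^sup>2 / 4 / (\<beta>\<^sup>2 / 4 + q / (4 * y))) powr \<alpha>)"
        using nn_integral_invgamma_dens_exp[of \<alpha> "\<beta>\<^sup>2 / 4" "q / (4 * y)"] \<alpha> \<beta> q True by simp
      also have "\<beta>\<^sup>2 / 4 / (\<beta>\<^sup>2 / 4 + q / (4 * y)) = y / (y + q / \<beta>\<^sup>2)"
        using \<beta> True by (simp add: field_simps)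
      finally show ?thesis
        using \<nu> by (simp add: ennreal_mult gamma_dens_nonneg)
    qed (simp add: H_def gamma_dens_def)
  qed
  finally show ?thesis .
qed

lemma nn_integral_gamma_dens_exp_le_1:
  assumes "0 < a" "0 < b" "0 \<le> q"
  shows "(\<integral>\<^sup>+r. ennreal (gamma_dens a b r * exp (- q / r)) \<partial>lborel) \<le> 1"
proof -
  have "(\<integral>\<^sup>+r. ennreal (gamma_dens a b r * exp (- q / r)) \<partial>lborel) \<le> (\<integral>\<^sup>+r. ennreal (gamma_dens a b r) \<partial>lborel)"
  proof (intro nn_integral_mono ennreal_leI)
    fix r
    show "gamma_dens a b r * exp (- q / r) \<le> gamma_dens a b r"
    proof (cases "0 < r")
      case True
      then have "exp (- q / r) \<le> 1"
        using assms by (simp add: divide_nonneg_pos)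
      then show ?thesis
        by (intro mult_left_le gamma_dens_nonneg assms(1))
    qed (simp add: gamma_dens_def)
  qed
  then show ?thesis
    using nn_integral_gamma_dens[OF assms(1,2)] by simp
qed

lemma set_integral_invgamma_gamma_mixture:
  assumes \<nu>: "0 < \<nu>" and \<alpha>: "0 < \<alpha>" and \<beta>: "0 < \<beta>" and q: "0 \<le> q" and K: "0 \<le> K"
  shows "(LINT p:{0<..}|lborel. invgamma_dens \<alpha> (\<beta>\<^sup>2 / 4) p *
      (LINT r:{0<..}|lborel. gamma_dens \<nu> (1 / (4 * p)) r * (K * exp (- q / r))))
    = K * enn2real (CH_gamma_mixture \<nu> \<alpha> (q / \<beta>\<^sup>2))"
proof -
  define E where "E p = (\<integral>\<^sup>+r. ennreal (gamma_dens \<nu> (1 / (4 * p)) r * exp (- q / r)) \<partial>lborel)" for p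
  have [measurable]: "E \<in> borel_measurable borel"
    unfolding E_def by measurable
  have E_finite: "ennreal (enn2real (E p)) = E p" if "0 < p" for p
  proof -
    have "E p \<le> 1"
      unfolding E_def using that by (intro nn_integral_gamma_dens_exp_le_1 \<nu> q) simp
    then show ?thesis
      using ennreal_one_less_top by (intro ennreal_enn2real) (rule le_less_trans)
  qed
  have inner: "(LINT r:{0<..}|lborel. gamma_dens \<nu> (1 / (4 * p)) r * (K * exp (- q / r)))
      = K * enn2real (E p)" for p
  proof -
    have "(LINT r:{0<..}|lborel. gamma_dens \<nu> (1 / (4 * p)) r * (K * exp (- q / r)))
        = enn2real (\<integral>\<^sup>+r. ennreal (gamma_dens \<nu> (1 / (4 * p)) r * (K * exp (- q / r))) * indicator {0<..} r \<partial>lborel)"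
      using \<nu> K by (intro set_integral_eq_nn_integral) (auto simp: gamma_dens_nonneg)
    also have "\<dots> = enn2real (ennreal K * E p)"
      unfolding E_def using K \<nu>
      by (subst nn_integral_cmult[symmetric])
         (auto intro!: arg_cong[where f = enn2real] nn_integral_cong
           simp: ennreal_mult[symmetric] gamma_dens_nonneg gamma_dens_def mult_ac indicator_def)
    finally show ?thesis
      using K by (simp add: enn2real_mult)
  qed
  have "(LINT p:{0<..}|lborel. invgamma_dens \<alpha> (\<beta>\<^sup>2 / 4) p *
      (LINT r:{0<..}|lborel. gamma_dens \<nu> (1 / (4 * p)) r * (K * exp (- q / r))))
      = enn2real (\<integral>\<^sup>+p. ennreal (invgamma_dens \<alpha> (\<beta>\<^sup>2 / 4) p * (K * enn2real (E p))) *
          indicator {0<..} p \<partial>lborel)"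
    unfolding inner using \<alpha> K
    by (intro set_integral_eq_nn_integral) (auto simp: invgamma_dens_nonneg)
  also have "\<dots> = enn2real (ennreal K * (\<integral>\<^sup>+p. ennreal (invgamma_dens \<alpha> (\<beta>\<^sup>2 / 4) p) * E p \<partial>lborel))"
    using \<alpha> K E_finite
    by (subst nn_integral_cmult[symmetric])
       (auto intro!: arg_cong[where f = enn2real] nn_integral_cong
         simp: ennreal_mult invgamma_dens_nonneg invgamma_dens_def mult_ac indicator_def)
  also have "\<dots> = K * enn2real (CH_gamma_mixture \<nu> \<alpha> (q / \<beta>\<^sup>2))"
    using nn_integral_invgamma_gamma_mixture[OF \<nu> \<alpha> \<beta> q] K by (simp add: E_def enn2real_mult)
  finally show ?thesis .
qed

theorem proposition2:
  fixes \<sigma>2 \<nu> \<alpha> \<beta> :: real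
    and lam :: "real^'n" and Lam :: "real^'n^'n"
    and h :: "real^'n" and u :: real
  assumes "\<sigma>2 > 0" and "\<nu> > 0" and "\<alpha> > 0" and "\<beta> > 0"
    and "transpose Lam = Lam"
    and "\<forall>x::real^'n. x \<noteq> 0 \<longrightarrow> x \<bullet> (Lam *v x) > 0"
  shows "Kmix \<sigma>2 \<nu> \<alpha> \<beta> lam Lam h u =
    \<sigma>2 * (det (mat 1 + u\<^sup>2 *\<^sub>R Lam)) powr (- 1 / 2) *
    CH (sqrt ((h - u *\<^sub>R lam) \<bullet> (matrix_inv (u\<^sup>2 *\<^sub>R Lam + mat 1) *v (h - u *\<^sub>R lam)))) \<nu> \<alpha> \<beta>"
proof -
  have Lam: "sym_pos_def Lam"
    using assms(5,6) by (simp add: sym_pos_def_def)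
  define q where "q = (h - u *\<^sub>R lam) \<bullet> (matrix_inv (u\<^sup>2 *\<^sub>R Lam + mat 1) *v (h - u *\<^sub>R lam))"
  define K where "K = \<sigma>2 * det (mat 1 + u\<^sup>2 *\<^sub>R Lam) powr (- 1 / 2)"
  have "sym_pos_def (u\<^sup>2 *\<^sub>R Lam + mat 1)"
    using sym_pos_def_add_scaleR[OF sym_pos_def_mat_1 Lam, of "u\<^sup>2"] by (simp add: add.commute)
  then have q: "0 \<le> q"
    unfolding q_def by (intro sym_pos_def_inner_nonneg sym_pos_def_matrix_inv)
  have K: "0 \<le> K"
    using assms(1) by (simp add: K_def)
  have "(LINT r:{0<..}|lborel. gamma_dens \<nu> (1 / (4 * p)) r * Clag \<sigma>2 lam Lam h u (sqrt r))
      = (LINT r:{0<..}|lborel. gamma_dens \<nu> (1 / (4 * p)) r * (K * exp (- q / r)))" for p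
    by (intro set_lebesgue_integral_cong) (auto simp: Clag_sqrt_eq[OF Lam] K_def q_def mult.assoc)
  then have "Kmix \<sigma>2 \<nu> \<alpha> \<beta> lam Lam h u = (LINT p:{0<..}|lborel. invgamma_dens \<alpha> (\<beta>\<^sup>2 / 4) p *
      (LINT r:{0<..}|lborel. gamma_dens \<nu> (1 / (4 * p)) r * (K * exp (- q / r))))"
    by (simp add: Kmix_def)
  also have "\<dots> = K * enn2real (CH_gamma_mixture \<nu> \<alpha> (q / \<beta>\<^sup>2))"
    using set_integral_invgamma_gamma_mixture[OF assms(2-4) q K] .
  also have "\<dots> = K * CH (sqrt q) \<nu> \<alpha> \<beta>"
    using q by (simp add: CH_eq_CH_gamma_mixture[OF assms(2,3)])
  finally show ?thesis
    by (simp add: K_def q_def)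
qed

end
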